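(* Let $\mathcal S=(S_1,\dots,S_N)$ be a global solution of the first-order system $$\dot S_i = S_i\Xi_i+\frac{\kappa}{N}\sum_{k=1}^N a_{ik}\Big[S_k-\tfrac12\big(S_iS_i^\top S_k+S_iS_k^\top S_i\big)\Big],\qquad S_i(0)=S_i^{\mathrm{in}}\in \mathrm{St}(p,n),\quad i=1,\dots,N.$$ Suppose that $\Xi_i=O$ for all $i=1,\dots,N$, that the network $(a_{ik})$ is an undirected and connected graph, and that $$\mathcal D(\mathcal S^{\mathrm{in}}):=\max_{1\le i,j\le N}\|S_i^{\mathrm{in}}-S_j^{\mathrm{in}}\|_{F}<\sqrt2 .$$ Then the system exhibits complete consensus exponentially fast: there exist constants $C,\lambda>0$ such that $\|S_i(t)-S_j(t)\|_{F}\le Ce^{-\lambda t}$ for all $t\ge 0$ and all $i,j=1,\dots,N$.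
   Context: $1\le p\le n$ and $N\ge 1$ are integers. $\mathrm{St}(p,n)=\{S\in\mathbb R^{n\times p}: S^\top S=I_p\}$ is the Stiefel manifold, $\|A\|_F=\sqrt{\mathrm{tr}(A^\top A)}$ is the Frobenius norm, and $O$ is the zero matrix. $\Xi_i\in\mathfrak{so}(p)$ are real skew-symmetric $p\times p$ matrices and $\kappa>0$ is the coupling strength. The network weights satisfy the standing assumption $a_{ik}=a_{ki}>0$. A global solution is a solution existing for all $t\ge0$ (with $S_i(t)\in\mathrm{St}(p,n)$). Complete consensus means $\lim_{t\to\infty}\|S_i(t)-S_j(t)\|_F=0$ for all $i,j$. *)

theory Defs
  imports "Graph_Theory.Digraph_Component" "HOL-Analysis.Analysis"
begin

text \<open>The type \<open>real^'p^'n\<close> is that of matrices with \<open>CARD('n)\<close> rows and \<open>CARD('p)\<close> columns.\<close>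

definition stiefel :: "(real^'p^'n) set" where
  "stiefel = {S. transpose S ** S = mat 1}"

definition skew_matrices :: "(real^'p^'p) set" where
  "skew_matrices = {X. transpose X = - X}"

definition frob_norm :: "real^'p^'n \<Rightarrow> real" where
  "frob_norm A = sqrt (trace (transpose A ** A))"

lemma frob_norm_eq_norm: "frob_norm A = norm A"
proof -
  have "trace (transpose A ** A) = (\<Sum>i\<in>UNIV. \<Sum>k\<in>UNIV. A $ k $ i * A $ k $ i)"
    by (simp add: trace_def matrix_matrix_mult_def transpose_def)
  also have "\<dots> = (\<Sum>k\<in>UNIV. \<Sum>i\<in>UNIV. A $ k $ i * A $ k $ i)"
    by (rule sum.swap)
  also have "\<dots> = A \<bullet> A"
    by (simp add: inner_vec_def)
  finally show ?thesis
    by (simp add: frob_norm_def norm_eq_sqrt_inner)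
qed

text \<open>Agents are indexed by \<open>{1..N}\<close>; values of the families at other indices are irrelevant.\<close>

definition vector_field ::
  "nat \<Rightarrow> real \<Rightarrow> (nat \<Rightarrow> nat \<Rightarrow> real) \<Rightarrow> (nat \<Rightarrow> real^'p^'p) \<Rightarrow> (nat \<Rightarrow> real^'p^'n) \<Rightarrow> nat \<Rightarrow> real^'p^'n"
where
  "vector_field N \<kappa> a \<Xi> S i =
     S i ** \<Xi> i +
     (\<kappa> / real N) *\<^sub>R (\<Sum>k=1..N. a i k *\<^sub>R
        (S k - (1/2) *\<^sub>R (S i ** transpose (S i) ** S k + S i ** transpose (S k) ** S i)))"

text \<open>The derivative at time \<open>0\<close> is the one-sided one.\<close>

definition global_solution ::
  "nat \<Rightarrow> real \<Rightarrow> (nat \<Rightarrow> nat \<Rightarrow> real) \<Rightarrow> (nat \<Rightarrow> real^'p^'p) \<Rightarrow> (nat \<Rightarrow> real^'p^'n) \<Rightarrow>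
   (nat \<Rightarrow> real \<Rightarrow> real^'p^'n) \<Rightarrow> bool"
where
  "global_solution N \<kappa> a \<Xi> Sin S \<longleftrightarrow>
     (\<forall>i\<in>{1..N}. S i 0 = Sin i \<and>
        (\<forall>t\<ge>0. S i t \<in> stiefel \<and>
           (S i has_vector_derivative vector_field N \<kappa> a \<Xi> (\<lambda>k. S k t) i) (at t within {0..})))"

text \<open>Undirected graphs are rendered as symmetric digraphs.  Loops are left out: the
  \<open>k = i\<close> term of the coupling sum vanishes on the Stiefel manifold.\<close>

definition network_graph :: "nat \<Rightarrow> (nat \<Rightarrow> nat \<Rightarrow> real) \<Rightarrow> (nat, nat \<times> nat) pre_digraph" where
  "network_graph N a = with_proj
     \<lparr>pverts = {1..N}, parcs = {(i, k). i \<in> {1..N} \<and> k \<in> {1..N} \<and> i \<noteq> k \<and> a i k > 0}\<rparr>"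

definition diameter_F :: "nat \<Rightarrow> (nat \<Rightarrow> real^'p^'n) \<Rightarrow> real" where
  "diameter_F N S = Max {frob_norm (S i - S j) | i j. i \<in> {1..N} \<and> j \<in> {1..N}}"

definition complete_consensus :: "nat \<Rightarrow> (nat \<Rightarrow> real \<Rightarrow> real^'p^'n) \<Rightarrow> bool" where
  "complete_consensus N S \<longleftrightarrow>
     (\<forall>i\<in>{1..N}. \<forall>j\<in>{1..N}. ((\<lambda>t. frob_norm (S i t - S j t)) \<longlongrightarrow> 0) at_top)"

end

theory Submission
  imports Defs
begin

text \<open>
  On the Stiefel manifold the squared distance is \<open>2 p - 2 (S\<^sub>i \<bullet> S\<^sub>j)\<close>, so it suffices to
  follow Frobenius inner products. Write \<open>E = S\<^sub>i - S\<^sub>k\<close> and \<open>F = S\<^sub>i - S\<^sub>j\<close>. Since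
  \<open>S\<^sub>i\<^sup>T S\<^sub>k + S\<^sub>k\<^sup>T S\<^sub>i = 2 I - E\<^sup>T E\<close>, the coupling term of agent \<open>k\<close> in the equation of agent \<open>i\<close>
  equals \<open>S\<^sub>k - S\<^sub>i + S\<^sub>i E\<^sup>T E / 2\<close> (\<open>coupling_rewrite\<close>). Its inner product with \<open>S\<^sub>j\<close> consists of a
  linear part \<open>(|F|\<^sup>2 - |S\<^sub>k - S\<^sub>j|\<^sup>2) / 2\<close> and a quadratic part \<open>(S\<^sub>j E\<^sup>T) \<bullet> (S\<^sub>i E\<^sup>T) / 2\<close>. Multiplication
  by \<open>S\<^sub>i\<close> or \<open>S\<^sub>j\<close> preserves norms, so polarisation and submultiplicativity of the Frobenius norm
  bound the quadratic part below by \<open>|E|\<^sup>2 (1 - |F|\<^sup>2 / 2) / 2\<close> (\<open>inner_coupling_ge\<close>).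

  If the pair \<open>(i, j)\<close> realises the diameter and the diameter is at most \<open>\<surd>2\<close>, both parts are
  nonnegative for every \<open>k\<close>, and for \<open>k = j\<close> the linear part alone contributes \<open>|F|\<^sup>2 / 2\<close>. All weights
  are positive, so a pair at maximal distance is linked directly, and its squared distance decreases
  at a rate proportional to itself (\<open>inner_vector_field_ge\<close>). The threshold \<open>\<surd>2\<close> is therefore never
  reached.

  The maximal pair changes with time and the diameter need not be differentiable.
  The lemma \<open>finite_family_exponential_decay\<close> turns the estimate at maximal pairs into exponential
  decay of all squared distances, by looking at the first time at which one of them meets an
  exponential barrier.
\<close>

section \<open>The Frobenius inner product\<close>

lemma inner_matrix_mult_left:
  fixes X :: "real^'p^'n" and Y :: "real^'m^'n" and Z :: "real^'p^'m"
  shows "X \<bullet> (Y ** Z) = (transpose Y ** X) \<bullet> Z"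
proof -
  have "X \<bullet> (Y ** Z) = (\<Sum>i\<in>UNIV. \<Sum>j\<in>UNIV. \<Sum>k\<in>UNIV. X$i$j * (Y$i$k * Z$k$j))"
    by (simp add: inner_vec_def matrix_matrix_mult_def sum_distrib_left)
  also have "\<dots> = (\<Sum>i\<in>UNIV. \<Sum>k\<in>UNIV. \<Sum>j\<in>UNIV. X$i$j * (Y$i$k * Z$k$j))"
    by (intro sum.cong refl sum.swap)
  also have "\<dots> = (\<Sum>k\<in>UNIV. \<Sum>i\<in>UNIV. \<Sum>j\<in>UNIV. X$i$j * (Y$i$k * Z$k$j))"
    by (rule sum.swap)
  also have "\<dots> = (\<Sum>k\<in>UNIV. \<Sum>j\<in>UNIV. \<Sum>i\<in>UNIV. X$i$j * (Y$i$k * Z$k$j))"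
    by (intro sum.cong refl sum.swap)
  also have "\<dots> = (transpose Y ** X) \<bullet> Z"
    by (simp add: inner_vec_def matrix_matrix_mult_def transpose_def sum_distrib_left sum_distrib_right
        mult_ac)
  finally show ?thesis .
qed

lemma inner_matrix_mult_right:
  fixes X :: "real^'p^'n" and Y :: "real^'m^'n" and Z :: "real^'p^'m"
  shows "X \<bullet> (Y ** Z) = (X ** transpose Z) \<bullet> Y"
proof -
  have "X \<bullet> (Y ** Z) = (\<Sum>i\<in>UNIV. \<Sum>j\<in>UNIV. \<Sum>k\<in>UNIV. X$i$j * (Y$i$k * Z$k$j))"
    by (simp add: inner_vec_def matrix_matrix_mult_def sum_distrib_left)
  also have "\<dots> = (\<Sum>i\<in>UNIV. \<Sum>k\<in>UNIV. \<Sum>j\<in>UNIV. X$i$j * (Y$i$k * Z$k$j))"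
    by (intro sum.cong refl sum.swap)
  also have "\<dots> = (X ** transpose Z) \<bullet> Y"
    by (simp add: inner_vec_def matrix_matrix_mult_def transpose_def sum_distrib_left sum_distrib_right
        mult_ac)
  finally show ?thesis .
qed

lemma norm_power2_rows:
  fixes X :: "real^'p^'n"
  shows "(norm X)\<^sup>2 = (\<Sum>r\<in>UNIV. (norm (X$r))\<^sup>2)"
  by (simp add: power2_norm_eq_inner inner_vec_def)

text \<open>
  Submultiplicativity is stated for a product with a transpose because the entries of
  \<open>F ** transpose E\<close> are the inner products of rows of \<open>F\<close> with rows of \<open>E\<close>, so that the
  Cauchy--Schwarz inequality applies entry by entry.
\<close>

lemma norm_matrix_mult_transpose_le:
  fixes F :: "real^'p^'n" and E :: "real^'p^'m"
  shows "(norm (F ** transpose E))\<^sup>2 \<le> (norm F)\<^sup>2 * (norm E)\<^sup>2"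
proof -
  have "(norm (F ** transpose E))\<^sup>2 = (\<Sum>r\<in>UNIV. \<Sum>s\<in>UNIV. (F$r \<bullet> E$s)\<^sup>2)"
    by (simp add: power2_norm_eq_inner)
       (simp add: inner_vec_def matrix_matrix_mult_def transpose_def power2_eq_square)
  also have "\<dots> \<le> (\<Sum>r\<in>UNIV. \<Sum>s\<in>UNIV. (norm (F$r))\<^sup>2 * (norm (E$s))\<^sup>2)"
    by (intro sum_mono) (metis Cauchy_Schwarz_ineq power2_norm_eq_inner)
  also have "\<dots> = (norm F)\<^sup>2 * (norm E)\<^sup>2"
    by (simp add: norm_power2_rows sum_product)
  finally show ?thesis .
qed

section \<open>Geometry of the Stiefel manifold\<close>

lemma stiefel_isometry:
  fixes S :: "real^'p^'n" and M :: "real^'m^'p"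
  assumes "S \<in> stiefel"
  shows "norm (S ** M) = norm M"
proof -
  have "(S ** M) \<bullet> (S ** M) = (transpose S ** S ** M) \<bullet> M"
    by (simp add: inner_matrix_mult_left matrix_mul_assoc)
  also have "\<dots> = M \<bullet> M"
    using assms by (simp add: stiefel_def)
  finally show ?thesis
    by (simp add: norm_eq_sqrt_inner)
qed

lemma stiefel_inner_self:
  fixes S :: "real^'p^'n"
  assumes "S \<in> stiefel"
  shows "S \<bullet> S = real CARD('p)"
proof -
  have "S \<bullet> S = (transpose S ** S) \<bullet> mat 1"
    using inner_matrix_mult_left[of S S "mat 1"] by simp
  also have "\<dots> = (\<Sum>i\<in>(UNIV::'p set). 1)"
    using assms by (simp add: stiefel_def inner_vec_def mat_def if_distrib cong: if_cong)
  finally show ?thesis by simp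
qed

lemma stiefel_norm_diff:
  fixes S T :: "real^'p^'n"
  assumes "S \<in> stiefel" "T \<in> stiefel"
  shows "(norm (S - T))\<^sup>2 = 2 * real CARD('p) - 2 * (S \<bullet> T)"
  using assms
  by (simp add: power2_norm_eq_inner inner_diff_left inner_diff_right stiefel_inner_self inner_commute)

lemma transpose_diff: "transpose (A - B) = transpose A - transpose (B :: real^'p^'n)"
  by (simp add: transpose_def vec_eq_iff)

lemma matrix_diff_ldistrib: "A ** (B - C) = A ** B - A ** (C :: real^'p^'n)"
  for A :: "real^'n^'m"
  by (simp add: vec_eq_iff matrix_matrix_mult_def right_diff_distrib sum_subtractf)

lemma matrix_diff_rdistrib: "(A - B) ** C = A ** C - B ** (C :: real^'p^'n)"
  for A :: "real^'n^'m"
  by (simp add: vec_eq_iff matrix_matrix_mult_def left_diff_distrib sum_subtractf)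

text \<open>
  This form shows the coupling as attraction towards \<open>Sk\<close> plus a correction of second order
  in the distance, and it replaces the two matrix products by a single Gram matrix.
\<close>

lemma coupling_rewrite:
  fixes Si Sk :: "real^'p^'n"
  assumes "Si \<in> stiefel" "Sk \<in> stiefel"
  shows "Sk - (1/2) *\<^sub>R (Si ** transpose Si ** Sk + Si ** transpose Sk ** Si)
       = Sk - Si + (1/2) *\<^sub>R (Si ** (transpose (Si - Sk) ** (Si - Sk)))"
proof -
  have "transpose (Si - Sk) ** (Si - Sk)
      = (mat 1 - transpose Si ** Sk) + (mat 1 - transpose Sk ** Si)"
    using assms
    by (simp add: stiefel_def transpose_diff matrix_diff_ldistrib matrix_diff_rdistrib)
  then have gram: "Si ** (transpose (Si - Sk) ** (Si - Sk))
      = (Si - Si ** transpose Si ** Sk) + (Si - Si ** transpose Sk ** Si)"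
    by (simp only: matrix_add_ldistrib matrix_diff_ldistrib matrix_mul_assoc matrix_mul_rid)
  show ?thesis
    unfolding gram by (simp add: vec_eq_iff field_simps)
qed

text \<open>
  The factor \<open>1 - (norm (Si - Sj))\<^sup>2 / 2\<close> is where the threshold \<open>\<surd>2\<close> on the diameter originates. It
  appears because the two matrices \<open>Si ** transpose E\<close> and \<open>Sj ** transpose E\<close>, with \<open>E = Si - Sk\<close>,
  have the same norm as \<open>E\<close> and differ by \<open>(Si - Sj) ** transpose E\<close>; hence their inner product
  is close to the square of that norm.
\<close>

lemma inner_coupling_ge:
  fixes Si Sj Sk :: "real^'p^'n"
  assumes st: "Si \<in> stiefel" "Sj \<in> stiefel" "Sk \<in> stiefel"
  shows "Sj \<bullet> (Sk - (1/2) *\<^sub>R (Si ** transpose Si ** Sk + Si ** transpose Sk ** Si))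
       \<ge> ((norm (Si - Sj))\<^sup>2 - (norm (Sk - Sj))\<^sup>2) / 2
         + (norm (Si - Sk))\<^sup>2 / 2 * (1 - (norm (Si - Sj))\<^sup>2 / 2)"
proof -
  define E where "E = Si - Sk"
  define F where "F = Si - Sj"
  have "norm (S ** transpose E) = norm E" if "S \<in> stiefel" for S :: "real^'p^'n"
  proof -
    have "norm (transpose E) = norm E"
      by (metis frob_norm_eq_norm frob_norm_def trace_mul_sym transpose_transpose)
    with stiefel_isometry[OF that, of "transpose E"] show ?thesis by simp
  qed
  then have iso: "(norm (Si ** transpose E))\<^sup>2 = (norm E)\<^sup>2" "(norm (Sj ** transpose E))\<^sup>2 = (norm E)\<^sup>2"
    using st by simp_all
  have "Sj \<bullet> (Si ** (transpose E ** E)) = (Sj ** transpose E) \<bullet> (Si ** transpose E)"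
    using inner_matrix_mult_right[of Sj "Si ** transpose E" E] by (simp add: matrix_mul_assoc)
  \<comment> \<open>polarisation, for two matrices of norm \<open>norm E\<close>\<close>
  also have "\<dots> = (norm E)\<^sup>2 - (norm (F ** transpose E))\<^sup>2 / 2"
    using iso
    by (simp add: F_def matrix_diff_rdistrib power2_norm_eq_inner inner_diff_left inner_diff_right
        inner_commute diff_divide_distrib)
  also have "\<dots> \<ge> (norm E)\<^sup>2 * (1 - (norm F)\<^sup>2 / 2)"
    using norm_matrix_mult_transpose_le[of F E] by (simp add: algebra_simps)
  finally have quad: "Sj \<bullet> (Si ** (transpose E ** E)) \<ge> (norm E)\<^sup>2 * (1 - (norm F)\<^sup>2 / 2)" .
  have lin: "Sj \<bullet> (Sk - Si) = ((norm F)\<^sup>2 - (norm (Sk - Sj))\<^sup>2) / 2"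
    using st by (simp add: F_def stiefel_norm_diff inner_diff_right inner_commute)
  show ?thesis
    unfolding coupling_rewrite[OF st(1,3)] E_def[symmetric] F_def[symmetric]
    using quad by (simp add: inner_add_right lin)
qed

section \<open>Decay of the maximum of a finite family\<close>

text \<open>
  A comparison principle that needs a differential inequality only for those members of the
  family that are maximal at the given time. At the first time \<open>T\<close> at which
  \<open>g j = (\<lambda>t. f j t * exp (c * t))\<close> reaches the level \<open>M\<close> for some \<open>j\<close>, choose \<open>j\<close> maximal.
  The inequality makes \<open>g j\<close> strictly decreasing at \<open>T\<close>, so \<open>g j\<close> exceeds \<open>M\<close> just before \<open>T\<close>,
  which is impossible. Strictness in the assumption \<open>decay\<close> is essential for this step. Because
  the barrier \<open>M * exp (- c * t)\<close> stays below \<open>M\<close>, the inequality is required only for values up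
  to \<open>M\<close>.
\<close>

lemma finite_family_exponential_decay:
  fixes f f' :: "'i \<Rightarrow> real \<Rightarrow> real"
  assumes fin: "finite I"
    and deriv: "\<And>i t. i \<in> I \<Longrightarrow> t \<ge> 0 \<Longrightarrow> (f i has_real_derivative f' i t) (at t within {0..})"
    and decay: "\<And>i t. i \<in> I \<Longrightarrow> t \<ge> 0 \<Longrightarrow> 0 < f i t \<Longrightarrow> f i t \<le> M \<Longrightarrow>
                  (\<And>j. j \<in> I \<Longrightarrow> f j t \<le> f i t) \<Longrightarrow> f' i t < - c * f i t"
    and init: "\<And>i. i \<in> I \<Longrightarrow> f i 0 < M"
    and M: "0 < M" and c: "0 \<le> c"
    and i: "i \<in> I" and t: "t \<ge> 0"
  shows "f i t < M * exp (- c * t)"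
proof (rule ccontr)
  assume not_less: "\<not> f i t < M * exp (- c * t)"
  define g where "g = (\<lambda>i t. f i t * exp (c * t))"
  have g_iff: "g j s < M \<longleftrightarrow> f j s < M * exp (- c * s)" "g j s = M \<longleftrightarrow> f j s = M * exp (- c * s)" for j s
    by (simp_all add: g_def exp_minus field_simps)
  have dg: "(g j has_real_derivative (f' j s + c * f j s) * exp (c * s)) (at s within {0..})"
    if "j \<in> I" "s \<ge> 0" for j s
    unfolding g_def
    by (rule derivative_eq_intros deriv[OF that] refl | simp add: algebra_simps)+
  then have cont: "continuous_on {0..} (g j)" if "j \<in> I" for j
    using that by (auto intro!: DERIV_continuous_on)
  define Z where "Z = (\<Union>j\<in>I. {0..} \<inter> g j -` {M..})"
  have "closed Z"
    unfolding Z_def using fin cont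
    by (intro closed_UN ballI continuous_closed_preimage) auto
  moreover have "t \<in> Z"
  proof -
    have "M \<le> g i t"
      using not_less g_iff(1)[of i t] by linarith
    with i t show ?thesis by (auto simp: Z_def)
  qed
  moreover have bdd: "bdd_below Z"
    by (rule bdd_belowI[of _ 0]) (auto simp: Z_def)
  ultimately have "Inf Z \<in> Z"
    by (intro closed_contains_Inf) auto
  define T where "T = Inf Z"
  have before: "g j s < M" if "j \<in> I" "0 \<le> s" "s < T" for j s
  proof (rule ccontr)
    assume "\<not> g j s < M"
    then have "M \<le> g j s" by simp
    with that have "s \<in> Z" by (auto simp: Z_def)
    with cInf_lower[OF this bdd] that show False by (simp add: T_def)
  qed
  from \<open>Inf Z \<in> Z\<close> obtain k where k: "k \<in> I" "g k T \<ge> M" and "T \<ge> 0"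
    by (auto simp: Z_def T_def)
  have "T \<noteq> 0"
    using k init[of k] by (auto simp: g_def)
  with \<open>T \<ge> 0\<close> have T: "T > 0" by simp
  \<comment> \<open>The member \<open>k\<close> that reaches the barrier need not be maximal, so pass to a maximal one.\<close>
  obtain j where j: "j \<in> I" "\<And>l. l \<in> I \<Longrightarrow> f l T \<le> f j T"
  proof -
    have "Max ((\<lambda>l. f l T) ` I) \<in> (\<lambda>l. f l T) ` I"
      using fin i by (intro Max_in) auto
    then obtain j where "j \<in> I" "Max ((\<lambda>l. f l T) ` I) = f j T" by auto
    with that[of j] Max_ge[of "(\<lambda>l. f l T) ` I"] fin show ?thesis by auto
  qed
  have "g k T \<le> g j T"
    using j(2)[OF k(1)] by (simp add: g_def)
  with k have "g j T \<ge> M" by simp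
  moreover have "\<not> g j T > M"
  proof
    assume "g j T > M"
    moreover have "g j 0 < M" using init[OF j(1)] by (simp add: g_def)
    moreover have "continuous_on {0..T} (g j)"
      using cont[OF j(1)] by (rule continuous_on_subset) auto
    ultimately obtain s where "0 \<le> s" "s \<le> T" "g j s = M"
      using IVT'[of "g j" 0 M T] T by auto
    with before[OF j(1), of s] \<open>g j T > M\<close> show False by (cases "s = T") auto
  qed
  ultimately have gj: "g j T = M" by simp
  then have fj: "f j T = M * exp (- c * T)" by (simp add: g_iff)
  have "f j T \<le> M"
    using fj M c T by simp
  then have "f' j T + c * f j T < 0"
    using decay[OF j(1), of T] j(2) T fj M by fastforce
  then have "(f' j T + c * f j T) * exp (c * T) < 0"
    by (simp add: mult_neg_pos)
  from has_real_derivative_neg_dec_left[OF dg[OF j(1), of T] this] T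
  obtain d where d: "d > 0" "\<And>h. h > 0 \<Longrightarrow> T - h \<in> {0..} \<Longrightarrow> h < d \<Longrightarrow> g j T < g j (T - h)"
    by auto
  define h where "h = min (d / 2) (T / 2)"
  have "g j T < g j (T - h)"
    using d(1) T by (intro d(2)) (auto simp: h_def min_def)
  moreover have "g j (T - h) < M"
    using d(1) T by (intro before j) (auto simp: h_def min_def)
  ultimately show False using gj by simp
qed

section \<open>Consensus\<close>

text \<open>
  It is enough that the distance from \<open>S j\<close> is maximal at \<open>S i\<close>: then no agent contributes negatively
  to the coupling sum, and keeping only the contribution of agent \<open>j\<close> itself gives a bound
  proportional to the squared distance.
\<close>

lemma inner_vector_field_ge:
  fixes S :: "nat \<Rightarrow> real^'p^'n"
  assumes st: "\<And>k. k \<in> {1..N} \<Longrightarrow> S k \<in> stiefel"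
    and a: "\<And>k. k \<in> {1..N} \<Longrightarrow> a i k \<ge> 0"
    and \<kappa>: "\<kappa> > 0" and \<Xi>: "\<Xi> i = 0"
    and ij: "i \<in> {1..N}" "j \<in> {1..N}"
    and max: "\<And>k. k \<in> {1..N} \<Longrightarrow> norm (S k - S j) \<le> norm (S i - S j)"
    and le: "(norm (S i - S j))\<^sup>2 \<le> 2"
  shows "S j \<bullet> vector_field N \<kappa> a \<Xi> S i \<ge> \<kappa> / real N * (a i j * ((norm (S i - S j))\<^sup>2 / 2))"
proof -
  define h where "h k = S j \<bullet> (S k - (1/2) *\<^sub>R (S i ** transpose (S i) ** S k
                                          + S i ** transpose (S k) ** S i))" for k
  have h: "h k \<ge> ((norm (S i - S j))\<^sup>2 - (norm (S k - S j))\<^sup>2) / 2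
         + (norm (S i - S k))\<^sup>2 / 2 * (1 - (norm (S i - S j))\<^sup>2 / 2)" if "k \<in> {1..N}" for k
    unfolding h_def using inner_coupling_ge st ij that by blast
  have quad: "0 \<le> (norm (S i - S k))\<^sup>2 / 2 * (1 - (norm (S i - S j))\<^sup>2 / 2)" for k
    using le by simp
  have "h j \<ge> (norm (S i - S j))\<^sup>2 / 2"
    using h[OF ij(2)] quad[of j] by simp
  then have "a i j * ((norm (S i - S j))\<^sup>2 / 2) \<le> a i j * h j"
    using a ij by (intro mult_left_mono) auto
  also have "\<dots> \<le> (\<Sum>k=1..N. a i k * h k)"
  proof (rule member_le_sum)
    fix k assume "k \<in> {1..N} - {j}"
    then have k: "k \<in> {1..N}" by simp
    have "(norm (S k - S j))\<^sup>2 \<le> (norm (S i - S j))\<^sup>2"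
      using max[OF k] by (intro power_mono) auto
    then have "0 \<le> ((norm (S i - S j))\<^sup>2 - (norm (S k - S j))\<^sup>2) / 2" by simp
    with h[OF k] quad[of k] have "h k \<ge> 0" by linarith
    with a[OF k] show "0 \<le> a i k * h k" by simp
  qed (use ij in auto)
  finally have "\<kappa> / real N * (a i j * ((norm (S i - S j))\<^sup>2 / 2)) \<le> \<kappa> / real N * (\<Sum>k=1..N. a i k * h k)"
    using \<kappa> by (intro mult_left_mono) auto
  also have "\<dots> = S j \<bullet> vector_field N \<kappa> a \<Xi> S i"
    by (simp add: vector_field_def \<Xi> h_def inner_sum_right)
  finally show ?thesis .
qed

lemma norm_le_diameter_F:
  assumes "i \<in> {1..N}" "j \<in> {1..N}"
  shows "norm (S i - S j) \<le> diameter_F N S"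
proof -
  let ?D = "{frob_norm (S i - S j) | i j. i \<in> {1..N} \<and> j \<in> {1..N}}"
  have "?D \<subseteq> (\<lambda>(i, j). frob_norm (S i - S j)) ` ({1..N} \<times> {1..N})"
    by auto
  then have "finite ?D"
    by (rule finite_subset) simp
  moreover have "frob_norm (S i - S j) \<in> ?D"
    using assms by blast
  ultimately have "frob_norm (S i - S j) \<le> diameter_F N S"
    unfolding diameter_F_def by (rule Max_ge)
  then show ?thesis by (simp add: frob_norm_eq_norm)
qed

lemma exponential_bound_imp_complete_consensus:
  assumes r: "r > 0"
    and bound: "\<forall>t\<ge>0. \<forall>i\<in>{1..N}. \<forall>j\<in>{1..N}. frob_norm (S i t - S j t) \<le> C * exp (- r * t)"
  shows "complete_consensus N S"
  unfolding complete_consensus_def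
proof (intro ballI)
  fix i j assume ij: "i \<in> {1..N}" "j \<in> {1..N}"
  have "filterlim (\<lambda>t. r * t) at_top at_top"
    using r by (intro filterlim_tendsto_pos_mult_at_top[OF tendsto_const _ filterlim_ident])
  then have "filterlim (\<lambda>t. - r * t) at_bot at_top"
    by (simp add: filterlim_uminus_at_bot)
  then have "((\<lambda>t. exp (- r * t)) \<longlongrightarrow> 0) at_top"
    by (rule filterlim_compose[OF exp_at_bot])
  then have lim: "((\<lambda>t. C * exp (- r * t)) \<longlongrightarrow> 0) at_top"
    using tendsto_mult_right_zero by blast
  show "((\<lambda>t. frob_norm (S i t - S j t)) \<longlongrightarrow> 0) at_top"
  proof (rule tendsto_sandwich[OF _ _ tendsto_const lim])
    show "\<forall>\<^sub>F t in at_top. 0 \<le> frob_norm (S i t - S j t)"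
      by (simp add: frob_norm_eq_norm)
    show "\<forall>\<^sub>F t in at_top. frob_norm (S i t - S j t) \<le> C * exp (- r * t)"
      using eventually_ge_at_top[of 0] by eventually_elim (use bound ij in auto)
  qed
qed

theorem theorem1p1:
  fixes N :: nat
    and \<kappa> :: real
    and a :: "nat \<Rightarrow> nat \<Rightarrow> real"
    and \<Xi> :: "nat \<Rightarrow> real^'p^'p"
    and Sin :: "nat \<Rightarrow> real^'p^'n"
    and S :: "nat \<Rightarrow> real \<Rightarrow> real^'p^'n"
  assumes "CARD('p) \<le> CARD('n)"
    and "N \<ge> 1"
    and "\<kappa> > 0"
    and "\<forall>i\<in>{1..N}. \<forall>k\<in>{1..N}. a i k = a k i \<and> a i k > 0"
    and "\<forall>i\<in>{1..N}. \<Xi> i \<in> skew_matrices"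
    and "\<forall>i\<in>{1..N}. Sin i \<in> stiefel"
    and "global_solution N \<kappa> a \<Xi> Sin S"
    and "\<forall>i\<in>{1..N}. \<Xi> i = 0"
    and "graph (network_graph N a)"
    and "Digraph_Component.connected (network_graph N a)"
    and "diameter_F N Sin < sqrt 2"
  shows "complete_consensus N S \<and>
    (\<exists>C>0. \<exists>r>0. \<forall>t\<ge>0. \<forall>i\<in>{1..N}. \<forall>j\<in>{1..N}.
       frob_norm (S i t - S j t) \<le> C * exp (- r * t))"
proof -
  define P where "P = {1..N} \<times> {1..N}"
  define V where "V i t = vector_field N \<kappa> a \<Xi> (\<lambda>k. S k t) i" for i t
  define f where "f = (\<lambda>(i, j) t. 2 * real CARD('p) - 2 * (S i t \<bullet> S j t))"
  define f' where "f' = (\<lambda>(i, j) t. - 2 * (S j t \<bullet> V i t + S i t \<bullet> V j t))"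
  have S0: "S i 0 = Sin i" if "i \<in> {1..N}" for i
    using assms(7) that by (simp add: global_solution_def)
  have st: "S i t \<in> stiefel" if "i \<in> {1..N}" "t \<ge> 0" for i t
    using assms(7) that by (simp add: global_solution_def)
  have dS: "(S i has_vector_derivative V i t) (at t within {0..})" if "i \<in> {1..N}" "t \<ge> 0" for i t
    using assms(7) that by (simp add: global_solution_def V_def)
  have f_eq: "f (i, j) t = (norm (S i t - S j t))\<^sup>2" if "i \<in> {1..N}" "j \<in> {1..N}" "t \<ge> 0" for i j t
    using that by (simp add: f_def stiefel_norm_diff st)
  define m where "m = Min ((\<lambda>(i, j). a i j) ` P)"
  have P: "finite P" "P \<noteq> {}"
    using assms(2) by (auto simp: P_def)
  have "m \<in> (\<lambda>(i, j). a i j) ` P"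
    unfolding m_def using P by (intro Min_in) auto
  then have m_pos: "m > 0"
    using assms(4) by (auto simp: P_def)
  have m_le: "m \<le> a i j" if "i \<in> {1..N}" "j \<in> {1..N}" for i j
    unfolding m_def using that P by (intro Min_le) (auto simp: P_def)
  define c where "c = \<kappa> / real N * m"
  have c_pos: "c > 0"
    using assms(2,3) m_pos by (simp add: c_def)

  \<comment> \<open>At a maximal pair the squared distance decays at rate at least \<open>2 * c\<close>; the barrier uses the smaller rate
    \<open>c\<close>, which gives the strict inequality that the comparison principle asks for.\<close>
  have bound: "f p t < 2 * exp (- c * t)" if p: "p \<in> P" and t: "t \<ge> 0" for p t
  proof (rule finite_family_exponential_decay[of P f f' 2 c p t])
    fix q s assume q: "q \<in> P" and s: "s \<ge> (0::real)"
    then obtain i j where ij: "q = (i, j)" "i \<in> {1..N}" "j \<in> {1..N}" by (auto simp: P_def)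
    have "((\<lambda>t. S i t \<bullet> S j t) has_vector_derivative (S i s \<bullet> V j s + V i s \<bullet> S j s)) (at s within {0..})"
      by (rule bounded_bilinear.has_vector_derivative[OF bounded_bilinear_inner])
         (use ij s dS in auto)
    then have "((\<lambda>t. S i t \<bullet> S j t) has_real_derivative (S i s \<bullet> V j s + V i s \<bullet> S j s)) (at s within {0..})"
      by (simp add: has_real_derivative_iff_has_vector_derivative)
    then show "(f q has_real_derivative f' q s) (at s within {0..})"
      unfolding f_def f'_def ij(1) prod.case
      by (auto intro!: derivative_eq_intros simp: inner_commute)
    assume pos: "0 < f q s" and le: "f q s \<le> 2" and max: "\<And>l. l \<in> P \<Longrightarrow> f l s \<le> f q s"
    have sym: "norm (S j s - S i s) = norm (S i s - S j s)"
      by (rule norm_minus_commute)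
    have max1: "norm (S k s - S j s) \<le> norm (S i s - S j s)"
      and max2: "norm (S k s - S i s) \<le> norm (S j s - S i s)" if "k \<in> {1..N}" for k
      using max[of "(k, j)"] max[of "(k, i)"] that ij s sym
      by (auto simp: P_def f_eq intro: power2_le_imp_le)
    have V: "\<kappa> / real N * (a i j * (f q s / 2)) \<le> S j s \<bullet> V i s"
            "\<kappa> / real N * (a j i * (f q s / 2)) \<le> S i s \<bullet> V j s"
      using inner_vector_field_ge[of N "\<lambda>k. S k s" a i \<kappa> \<Xi> j]
            inner_vector_field_ge[of N "\<lambda>k. S k s" a j \<kappa> \<Xi> i]
            assms(3,4,8) ij s st le max1 max2 sym
      by (auto simp: f_eq V_def less_imp_le)
    have mono: "c * f q s / 2 \<le> \<kappa> / real N * (b * (f q s / 2))" if "m \<le> b" for b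
    proof -
      have "\<kappa> / real N * (m * (f q s / 2)) \<le> \<kappa> / real N * (b * (f q s / 2))"
        using that pos assms(3) by (intro mult_left_mono mult_right_mono) auto
      then show ?thesis by (simp add: c_def)
    qed
    have "c * f q s \<le> S j s \<bullet> V i s + S i s \<bullet> V j s"
      using V mono[OF m_le[of i j]] mono[OF m_le[of j i]] ij by linarith
    moreover have "c * f q s > 0" using c_pos pos by simp
    ultimately show "f' q s < - c * f q s"
      unfolding f'_def ij(1) by simp
  next
    fix q assume "q \<in> P"
    then obtain i j where ij: "q = (i, j)" "i \<in> {1..N}" "j \<in> {1..N}" by (auto simp: P_def)
    have "norm (Sin i - Sin j) < sqrt 2"
      using norm_le_diameter_F[OF ij(2,3), of Sin] assms(11) by simp
    then have "(norm (Sin i - Sin j))\<^sup>2 < 2"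
      by (metis norm_ge_zero real_sqrt_less_iff real_sqrt_abs abs_of_nonneg)
    then show "f q 0 < 2" using ij by (simp add: f_eq S0)
  qed (use P p t c_pos in auto)

  have "\<forall>t\<ge>0. \<forall>i\<in>{1..N}. \<forall>j\<in>{1..N}. frob_norm (S i t - S j t) \<le> sqrt 2 * exp (- (c / 2) * t)"
  proof (intro allI ballI impI)
    fix t :: real and i j assume t: "t \<ge> 0" and ij: "i \<in> {1..N}" "j \<in> {1..N}"
    have "(norm (S i t - S j t))\<^sup>2 \<le> 2 * exp (- c * t)"
      using bound[of "(i, j)" t] t ij by (simp add: P_def f_eq)
    also have "\<dots> = (sqrt 2 * exp (- (c / 2) * t))\<^sup>2"
      by (simp add: power_mult_distrib flip: exp_double)
    finally show "frob_norm (S i t - S j t) \<le> sqrt 2 * exp (- (c / 2) * t)"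
      unfolding frob_norm_eq_norm by (rule power2_le_imp_le) simp
  qed
  moreover from this have "complete_consensus N S"
    using c_pos by (intro exponential_bound_imp_complete_consensus[of "c / 2"]) auto
  ultimately show ?thesis
    using c_pos by (intro conjI exI[of _ "sqrt 2"] exI[of _ "c / 2"]) auto
qed

end
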